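(* For every three-qubit state $\rho_{ABC}$, $$I_{local}+I_{nonlocal}\le 3,$$ where $I_{local}=|\vec a|^2+|\vec b|^2+|\vec c|^2$ and $I_{nonlocal}=\max\{N_{AB}+N_{AC},\,N_{AB}+N_{BC},\,N_{AC}+N_{BC}\}$ with $N_{ij}=\max\{0,S_{ij}-1\}$.
   Context: $\vec a,\vec b,\vec c\in\mathbb R^3$ are the Bloch vectors of the single-qubit marginals of $\rho_{ABC}$: $a_k=\mathrm{Tr}[\rho_A\sigma_k]$, $b_k=\mathrm{Tr}[\rho_B\sigma_k]$, $c_k=\mathrm{Tr}[\rho_C\sigma_k]$ ($\sigma_k$ Pauli matrices). For a two-qubit state $\rho$ let $t_{kl}=\mathrm{Tr}[\rho\,\sigma_k\otimes\sigma_l]$ and $S(\rho)=\sum_{k,l=1}^3t_{kl}^2$; $S_{ij}=S(\rho_{ij})$ for the two-qubit reduced states $\rho_{ij}$ of $\rho_{ABC}$. *)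

theory Defs
  imports Complex_Main
begin

text \<open>Conventions: a qubit basis index is a bool (False = |0>, True = |1>).
 A three-qubit operator is a function (bool*bool*bool) => (bool*bool*bool) => complex,
 indices ordered (A,B,C); a two-qubit operator is (bool*bool) => (bool*bool) => complex;
 a one-qubit operator is bool => bool => complex.  M i j is the matrix entry <i|M|j>.\<close>

type_synonym op1 = "bool \<Rightarrow> bool \<Rightarrow> complex"
type_synonym op2 = "bool \<times> bool \<Rightarrow> bool \<times> bool \<Rightarrow> complex"
type_synonym op3 = "bool \<times> bool \<times> bool \<Rightarrow> bool \<times> bool \<times> bool \<Rightarrow> complex"

definition density3 :: "op3 \<Rightarrow> bool" where
  "density3 \<rho> \<longleftrightarrow>
     (\<forall>i j. \<rho> i j = cnj (\<rho> j i)) \<and>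
     (\<forall>v. 0 \<le> Re (\<Sum>i\<in>UNIV. \<Sum>j\<in>UNIV. cnj (v i) * \<rho> i j * v j)) \<and>
     (\<Sum>i\<in>UNIV. \<rho> i i) = 1"

definition pauli :: "nat \<Rightarrow> op1" where
  "pauli k i j =
     (if k = 1 then (if i \<noteq> j then 1 else 0)
      else if k = 2 then (if i = j then 0 else if i = False then - \<i> else \<i>)
      else if k = 3 then (if i \<noteq> j then 0 else if i = False then 1 else -1)
      else 0)"

definition ptrace_C :: "op3 \<Rightarrow> op2" where
  "ptrace_C \<rho> = (\<lambda>(a,b) (a',b'). \<Sum>c\<in>UNIV. \<rho> (a,b,c) (a',b',c))"
definition ptrace_B :: "op3 \<Rightarrow> op2" where
  "ptrace_B \<rho> = (\<lambda>(a,c) (a',c'). \<Sum>b\<in>UNIV. \<rho> (a,b,c) (a',b,c'))"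
definition ptrace_A :: "op3 \<Rightarrow> op2" where
  "ptrace_A \<rho> = (\<lambda>(b,c) (b',c'). \<Sum>a\<in>UNIV. \<rho> (a,b,c) (a,b',c'))"

definition ptrace2_second :: "op2 \<Rightarrow> op1" where
  "ptrace2_second \<sigma> = (\<lambda>x x'. \<Sum>y\<in>UNIV. \<sigma> (x,y) (x',y))"
definition ptrace2_first :: "op2 \<Rightarrow> op1" where
  "ptrace2_first \<sigma> = (\<lambda>y y'. \<Sum>x\<in>UNIV. \<sigma> (x,y) (x,y'))"

definition rho_AB :: "op3 \<Rightarrow> op2" where "rho_AB \<rho> = ptrace_C \<rho>"
definition rho_AC :: "op3 \<Rightarrow> op2" where "rho_AC \<rho> = ptrace_B \<rho>"
definition rho_BC :: "op3 \<Rightarrow> op2" where "rho_BC \<rho> = ptrace_A \<rho>"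
definition rho_A :: "op3 \<Rightarrow> op1" where "rho_A \<rho> = ptrace2_second (rho_AB \<rho>)"
definition rho_B :: "op3 \<Rightarrow> op1" where "rho_B \<rho> = ptrace2_first (rho_AB \<rho>)"
definition rho_C :: "op3 \<Rightarrow> op1" where "rho_C \<rho> = ptrace2_first (rho_AC \<rho>)"

text \<open>Bloch vector component: a_k = Tr[rho_1 sigma_k] (real for Hermitian rho_1).\<close>
definition bloch :: "op1 \<Rightarrow> nat \<Rightarrow> real" where
  "bloch \<rho>1 k = Re (\<Sum>x\<in>UNIV. \<Sum>x'\<in>UNIV. \<rho>1 x x' * pauli k x' x)"

definition bloch_norm2 :: "op1 \<Rightarrow> real" where
  "bloch_norm2 \<rho>1 = (\<Sum>k\<in>{1..3}. (bloch \<rho>1 k)\<^sup>2)"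

definition corr :: "op2 \<Rightarrow> nat \<Rightarrow> nat \<Rightarrow> real" where
  "corr \<sigma> k l = Re (\<Sum>(x,y)\<in>UNIV. \<Sum>(x',y')\<in>UNIV.
                       \<sigma> (x,y) (x',y') * (pauli k x' x * pauli l y' y))"

definition S2 :: "op2 \<Rightarrow> real" where
  "S2 \<sigma> = (\<Sum>k\<in>{1..3}. \<Sum>l\<in>{1..3}. (corr \<sigma> k l)\<^sup>2)"

definition Nq :: "op2 \<Rightarrow> real" where
  "Nq \<sigma> = max 0 (S2 \<sigma> - 1)"

definition I_local :: "op3 \<Rightarrow> real" where
  "I_local \<rho> = bloch_norm2 (rho_A \<rho>) + bloch_norm2 (rho_B \<rho>) + bloch_norm2 (rho_C \<rho>)"

definition I_nonlocal :: "op3 \<Rightarrow> real" where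
  "I_nonlocal \<rho> = Max {Nq (rho_AB \<rho>) + Nq (rho_AC \<rho>),
                        Nq (rho_AB \<rho>) + Nq (rho_BC \<rho>),
                        Nq (rho_AC \<rho>) + Nq (rho_BC \<rho>)}"

end

theory Submission
  imports Defs "HOL-Analysis.Analysis"
begin

text \<open>
  Unfolding the maxima leaves seven inequalities whose left-hand sides are sums of squares of linear
  functionals of the state, hence convex, so it suffices to treat pure states (a positive
  semidefinite matrix is a sum of rank-one ones, by iterated Schur complements). For a pure state the
  purities of complementary marginals agree, which gives
  \<open>S_AB = 1 + 2 |c|^2 - |a|^2 - |b|^2\<close> and its permutations. The only nontrivial case,
  \<open>|a|^2 + |b|^2 + |c|^2 + S_AB + S_AC \<le> 5\<close>, then becomes \<open>3 (|b|^2 + |c|^2) - S_BC \<le> 5\<close>.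
  With \<open>u\<close>, \<open>w\<close> the directions of \<open>b\<close>, \<open>c\<close>, positivity of
  \<open>(1 - u\<cdot>\<sigma>) \<otimes> (1 - w\<cdot>\<sigma>)\<close> bounds a single correlation from below by \<open>|b| + |c| - 1\<close>, so
  \<open>S_BC \<ge> (|b| + |c| - 1)^2\<close> when \<open>|b| + |c| \<ge> 1\<close>, and this is enough.
\<close>

section \<open>Positive semidefinite matrices\<close>

definition qform :: "('a::finite \<Rightarrow> 'a \<Rightarrow> complex) \<Rightarrow> ('a \<Rightarrow> complex) \<Rightarrow> real" where
  "qform M v = Re (\<Sum>i\<in>UNIV. \<Sum>j\<in>UNIV. cnj (v i) * M i j * v j)"

text \<open>The conditions of \<open>density3\<close> without the trace normalisation, so that
  rank-one pieces can be split off without rescaling.\<close>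

definition psd :: "('a::finite \<Rightarrow> 'a \<Rightarrow> complex) \<Rightarrow> bool" where
  "psd M \<longleftrightarrow> (\<forall>i j. M i j = cnj (M j i)) \<and> (\<forall>v. 0 \<le> qform M v)"

definition tr :: "('a::finite \<Rightarrow> 'a \<Rightarrow> complex) \<Rightarrow> real" where
  "tr M = Re (\<Sum>i\<in>UNIV. M i i)"

text \<open>The rank-one matrix of a vector that need not be normalised; bounds for it therefore
  carry powers of the trace in place of 1.\<close>

definition pure :: "('a \<Rightarrow> complex) \<Rightarrow> 'a \<Rightarrow> 'a \<Rightarrow> complex" where
  "pure v = (\<lambda>i j. v i * cnj (v j))"

definition madd :: "('a \<Rightarrow> 'a \<Rightarrow> complex) \<Rightarrow> ('a \<Rightarrow> 'a \<Rightarrow> complex) \<Rightarrow> 'a \<Rightarrow> 'a \<Rightarrow> complex" where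
  "madd M N = (\<lambda>i j. M i j + N i j)"

lemma psd_hermitian: "psd M \<Longrightarrow> M i j = cnj (M j i)"
  unfolding psd_def by blast

lemma psd_qform: "psd M \<Longrightarrow> 0 \<le> qform M v"
  unfolding psd_def by blast

text \<open>Expansion of the form along the \<open>i\<close>-th basis vector. By Hermiticity the two
  cross terms are conjugate, hence the single real part with factor 2.\<close>

lemma qform_upd:
  fixes M :: "'a::finite \<Rightarrow> 'a \<Rightarrow> complex"
  assumes herm: "\<And>i j. M i j = cnj (M j i)"
  shows "qform M (\<lambda>j. w j + (if j = i then t else 0)) =
    qform M w + 2 * Re (cnj t * (\<Sum>j\<in>UNIV. M i j * w j)) + (cmod t)\<^sup>2 * Re (M i i)"
proof -
  let ?s = "\<Sum>j\<in>UNIV. M i j * w j"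
  have sum_if: "(\<Sum>j\<in>UNIV. if Q then f j else 0) = (if Q then \<Sum>j\<in>UNIV. f j else 0)"
    for Q and f :: "'a \<Rightarrow> complex" by simp
  have "(\<Sum>k\<in>UNIV. \<Sum>j\<in>UNIV. cnj (w k + (if k = i then t else 0)) * M k j * (w j + (if j = i then t else 0)))
    = (\<Sum>k\<in>UNIV. \<Sum>j\<in>UNIV. cnj (w k) * M k j * w j
        + (if k = i then cnj t * (M k j * w j) else 0)
        + (if j = i then cnj (w k) * M k j * t else 0)
        + (if k = i then if j = i then cnj t * M k j * t else 0 else 0))"
    by (intro sum.cong refl) (auto simp: algebra_simps)
  also have "\<dots> = (\<Sum>k\<in>UNIV. \<Sum>j\<in>UNIV. cnj (w k) * M k j * w j)
     + (\<Sum>k\<in>UNIV. if k = i then (\<Sum>j\<in>UNIV. cnj t * (M k j * w j)) else 0)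
     + (\<Sum>k\<in>UNIV. cnj (w k) * M k i * t)
     + (\<Sum>k\<in>UNIV. if k = i then cnj t * M k i * t else 0)"
    by (simp add: sum.distrib sum_if)
  also have "\<dots> = (\<Sum>k\<in>UNIV. \<Sum>j\<in>UNIV. cnj (w k) * M k j * w j)
     + cnj t * ?s + (\<Sum>k\<in>UNIV. cnj (w k) * M k i * t) + cnj t * M i i * t"
    by (simp add: sum_distrib_left)
  also have "(\<Sum>k\<in>UNIV. cnj (w k) * M k i * t) = cnj (cnj t * ?s)"
    unfolding sum_distrib_left cnj_sum by (intro sum.cong refl) (simp add: herm[of _ i] mult_ac)
  finally have "qform M (\<lambda>j. w j + (if j = i then t else 0)) =
    Re ((\<Sum>k\<in>UNIV. \<Sum>j\<in>UNIV. cnj (w k) * M k j * w j) + cnj t * ?s + cnj (cnj t * ?s) + cnj t * M i i * t)"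
    unfolding qform_def by (rule arg_cong)
  also have "\<dots> = qform M w + 2 * Re (cnj t * ?s) + Re (cnj t * M i i * t)"
    unfolding qform_def plus_complex.sel cnj.sel by simp
  also have "Re (cnj t * M i i * t) = (cmod t)\<^sup>2 * Re (M i i)"
    unfolding cmod_power2 by (simp add: power2_eq_square algebra_simps)
  finally show ?thesis .
qed

text \<open>With a vanishing diagonal entry the form at \<open>e_j - s M_ij e_i\<close> is affine in
  the real parameter \<open>s\<close>; it stays nonnegative for all \<open>s\<close> only if its
  slope, a multiple of \<open>|M_ij|^2\<close>, is zero.\<close>

lemma psd_zero_diag:
  fixes M :: "'a::finite \<Rightarrow> 'a \<Rightarrow> complex"
  assumes "psd M" "Re (M i i) = 0"
  shows "M i j = 0" "M j i = 0"
proof -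
  let ?e = "\<lambda>k. if k = j then 1 else 0 :: complex"
  have e: "(\<Sum>k\<in>UNIV. M i k * ?e k) = M i j"
    by (simp add: if_distrib cong: if_cong)
  define q where "q = qform M ?e"
  have q: "0 \<le> q" unfolding q_def by (rule psd_qform[OF assms(1)])
  have *: "0 \<le> q - 2 * s * (cmod (M i j))\<^sup>2" for s
  proof -
    have "0 \<le> qform M ?e + 2 * Re (cnj (- of_real s * M i j) * M i j)"
      using psd_qform[OF assms(1), of "\<lambda>k. ?e k + (if k = i then - of_real s * M i j else 0)"]
        qform_upd[of M ?e i "- of_real s * M i j", OF psd_hermitian[OF assms(1)]] assms(2) e
      by simp
    then show ?thesis
      unfolding cmod_power2 q_def[symmetric] by (simp add: power2_eq_square algebra_simps)
  qed
  show "M i j = 0"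
  proof (rule ccontr)
    assume "M i j \<noteq> 0"
    then have "(cmod (M i j))\<^sup>2 > 0" by simp
    then show False
      using *[of "(q + 1) / (cmod (M i j))\<^sup>2"] q by simp
  qed
  then show "M j i = 0" using psd_hermitian[OF assms(1), of j i] by simp
qed

lemma psd_diag_nonneg:
  fixes M :: "'a::finite \<Rightarrow> 'a \<Rightarrow> complex"
  assumes "psd M"
  shows "0 \<le> Re (M i i)"
proof -
  have "qform M (\<lambda>j. 0 + (if j = i then 1 else 0)) = Re (M i i)"
    by (subst qform_upd[OF psd_hermitian[OF assms]]) (simp add: qform_def)
  then show ?thesis using psd_qform[OF assms] by metis
qed

text \<open>Completing the square: subtracting the rank-one matrix built from the scaled
  \<open>i\<close>-th column clears row and column \<open>i\<close>, and the remaining form at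
  \<open>w\<close> is the form of \<open>M\<close> minimised over changes of the \<open>i\<close>-th
  coordinate of \<open>w\<close>.\<close>

lemma psd_schur:
  fixes M :: "'a::finite \<Rightarrow> 'a \<Rightarrow> complex"
  assumes "psd M" and pos: "0 < Re (M i i)"
  defines "v \<equiv> \<lambda>j. M j i / of_real (sqrt (Re (M i i)))"
  shows "psd (\<lambda>j k. M j k - pure v j k)"
    and "M i j - pure v i j = 0" and "M j i - pure v j i = 0"
proof -
  let ?d = "Re (M i i)"
  note herm = psd_hermitian[OF assms(1)]
  have sq: "complex_of_real (sqrt ?d) * of_real (sqrt ?d) = of_real ?d"
    using pos by (simp flip: of_real_mult)
  have pv: "pure v j k = M j i * M i k / of_real ?d" for j k
    using sq herm[of i k] by (simp add: pure_def v_def)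
  have Mii: "M i i = of_real ?d"
    using herm[of i i] by (simp add: complex_eq_iff)
  show "M i j - pure v i j = 0" "M j i - pure v j i = 0"
    unfolding pv Mii[symmetric] using pos by (auto simp: field_simps)
  have "qform (\<lambda>j k. M j k - pure v j k) w \<ge> 0" for w
  proof -
    define s where "s = (\<Sum>j\<in>UNIV. M i j * w j)"
    have cs: "cnj s = (\<Sum>j\<in>UNIV. cnj (w j) * M j i)"
      unfolding s_def cnj_sum by (intro sum.cong refl) (simp add: herm[of _ i] mult_ac)
    have "(\<Sum>j\<in>UNIV. \<Sum>k\<in>UNIV. cnj (w j) * pure v j k * w k) = cnj s * s / of_real ?d"
      unfolding cs unfolding s_def pv sum_product sum_divide_distrib
      by (intro sum.cong refl) simp
    then have "qform (\<lambda>j k. M j k - pure v j k) w = qform M w - Re (cnj s * s / of_real ?d)"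
      unfolding qform_def by (simp add: right_diff_distrib left_diff_distrib sum_subtractf)
    also have "Re (cnj s * s / of_real ?d) = (cmod s)\<^sup>2 / ?d"
      unfolding cmod_power2 by (simp add: power2_eq_square)
    \<comment> \<open>The shift \<open>t = - s / d\<close> is the minimiser of
      \<open>2 Re (cnj t * s) + |t|^2 d\<close>, with minimum \<open>- |s|^2 / d\<close>.\<close>
    also have "qform M w - (cmod s)\<^sup>2 / ?d =
        qform M (\<lambda>j. w j + (if j = i then - s / of_real ?d else 0))"
    proof -
      have "Re (cnj (- s / of_real ?d) * s) = - ((cmod s)\<^sup>2 / ?d)"
        unfolding cmod_power2 by (simp add: power2_eq_square add_divide_distrib)
      moreover have "(cmod (- s / of_real ?d))\<^sup>2 * ?d = (cmod s)\<^sup>2 / ?d"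
        using pos by (simp add: norm_divide power_divide power2_eq_square)
      ultimately show ?thesis
        unfolding qform_upd[OF herm] s_def[symmetric] by linarith
    qed
    finally show ?thesis using psd_qform[OF assms(1)] by simp
  qed
  moreover have "M j k - pure v j k = cnj (M k j - pure v k j)" for j k
    using herm[of j k] by (simp add: pure_def)
  ultimately show "psd (\<lambda>j k. M j k - pure v j k)"
    unfolding psd_def by blast
qed

text \<open>Symmetric Gaussian elimination: each Schur step writes the matrix as a rank-one matrix
  plus a positive semidefinite one with smaller support.\<close>

lemma psd_induct [consumes 1, case_names zero pure add]:
  fixes M :: "'a::finite \<Rightarrow> 'a \<Rightarrow> complex"
  assumes "psd M"
    and zero: "P (\<lambda>_ _. 0)"
    and pure: "\<And>v. P (pure v)"
    and add: "\<And>M N. P M \<Longrightarrow> P N \<Longrightarrow> P (madd M N)"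
  shows "P M"
proof -
  \<comment> \<open>Generalised to matrices whose rows and columns vanish outside \<open>J\<close>;
    the induction removes one index at a time.\<close>
  have "P M" if "finite J" "psd M" "\<And>i j. i \<notin> J \<Longrightarrow> M i j = 0 \<and> M j i = 0" for J M
    using that
  proof (induction J arbitrary: M rule: finite_induct)
    case empty
    then have "M = (\<lambda>_ _. 0)" by blast
    then show ?case using zero by simp
  next
    case (insert i J)
    show ?case
    proof (cases "Re (M i i) = 0")
      case True
      show ?thesis
        by (rule insert.IH[OF insert.prems(1)])
          (metis True insert.prems insert_iff psd_zero_diag)
    next
      case False
      then have pos: "0 < Re (M i i)"
        using psd_diag_nonneg[OF insert.prems(1), of i] by simp
      define v where "v = (\<lambda>j. M j i / of_real (sqrt (Re (M i i))))"
      note sch = psd_schur[where M = M and i = i, OF insert.prems(1) pos, folded v_def]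
      have "P (\<lambda>j k. M j k - pure v j k)"
      proof (rule insert.IH[OF sch(1)])
        fix j k assume "j \<notin> J"
        show "M j k - pure v j k = 0 \<and> M k j - pure v k j = 0"
        proof (cases "j = i")
          case True
          then show ?thesis using sch(2,3) by simp
        next
          \<comment> \<open>Row and column \<open>j\<close> of \<open>M\<close> are already zero,
            and so is the entry \<open>v j\<close>, which is a multiple of
            \<open>M j i\<close>.\<close>
          case False
          with \<open>j \<notin> J\<close> have "M j l = 0" "M l j = 0" for l
            using insert.prems(2) by auto
          then show ?thesis by (simp add: pure_def v_def)
        qed
      qed
      from add[OF this pure[of v]] show ?thesis by (simp add: madd_def)
    qed
  qed
  from this[of UNIV M] assms(1) show ?thesis by simp
qed


section \<open>Two-qubit operators\<close>

lemma sum_bool: "(\<Sum>x\<in>(UNIV::bool set). f x) = f False + f True"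
  by (simp add: UNIV_bool add.commute)

lemma sum_pair:
  "(\<Sum>x\<in>(UNIV::('a::finite \<times> 'b::finite) set). f x) = (\<Sum>a\<in>UNIV. \<Sum>b\<in>UNIV. f (a, b))"
  by (simp add: sum.cartesian_product flip: UNIV_Times_UNIV)

lemma sum_1_3: "(\<Sum>k\<in>{1..3::nat}. f k) = f 1 + f 2 + f 3"
  by (simp add: numeral_eq_Suc)

lemmas qubit_sums = sum_bool sum_pair sum_1_3

section \<open>Purities in terms of Bloch vectors and correlations\<close>

lemma bloch_norm2_nonneg: "0 \<le> bloch_norm2 M"
  unfolding bloch_norm2_def by (simp add: sum_nonneg)

text \<open>Parseval in the orthogonal basis of the identity and the Pauli matrices, each of squared
  Hilbert-Schmidt norm 2.\<close>

lemma purity1: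
  assumes "\<And>i j. M i j = cnj (M j i)"
  shows "2 * (\<Sum>i\<in>UNIV. \<Sum>j\<in>UNIV. (cmod (M i j))\<^sup>2) = (tr M)\<^sup>2 + bloch_norm2 M"
proof -
  have "M True False = cnj (M False True)" "Im (M False False) = 0" "Im (M True True) = 0"
    using assms[of True False] assms[of True True] assms[of False False]
    by (auto simp: complex_eq_iff)
  then show ?thesis
    unfolding bloch_norm2_def bloch_def tr_def pauli_def cmod_power2 qubit_sums
    by (simp add: power2_eq_square algebra_simps)
qed

text \<open>Parseval for the sixteen tensor products of the identity and Pauli matrices, each of
  squared norm 4: products with one identity factor give the two Bloch vectors, those with none give
  \<open>S2\<close>.\<close>

lemma purity2:
  assumes "\<And>i j. M i j = cnj (M j i)"
  shows "4 * (\<Sum>i\<in>UNIV. \<Sum>j\<in>UNIV. (cmod (M i j))\<^sup>2) =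
    (tr M)\<^sup>2 + bloch_norm2 (ptrace2_second M) + bloch_norm2 (ptrace2_first M) + S2 M"
proof -
  have "M (True, True) (True, False) = cnj (M (True, False) (True, True))"
    "M (True, True) (False, True) = cnj (M (False, True) (True, True))"
    "M (True, True) (False, False) = cnj (M (False, False) (True, True))"
    "M (True, False) (False, True) = cnj (M (False, True) (True, False))"
    "M (True, False) (False, False) = cnj (M (False, False) (True, False))"
    "M (False, True) (False, False) = cnj (M (False, False) (False, True))"
    by (rule assms)+
  moreover have "Im (M i i) = 0" for i
    using assms[of i i] by (auto simp: complex_eq_iff)
  ultimately show ?thesis
    unfolding S2_def corr_def bloch_norm2_def bloch_def ptrace2_second_def ptrace2_first_def
      tr_def pauli_def cmod_power2 qubit_sums
    by (simp add: power2_eq_square algebra_simps)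
qed

text \<open>For a unit vector \<open>u\<close>, this is twice the projection onto the \<open>-1\<close> eigenspace of \<open>u\<cdot>\<sigma>\<close>.\<close>

definition antiproj :: "(nat \<Rightarrow> real) \<Rightarrow> op1" where
  "antiproj u i j = (if i = j then 1 else 0) - (\<Sum>k\<in>{1..3}. of_real (u k) * pauli k i j)"

lemma antiproj_hermitian: "cnj (antiproj u i j) = antiproj u j i"
  unfolding antiproj_def sum_1_3 by (cases i; cases j) (auto simp: pauli_def)

text \<open>For a unit vector \<open>(u\<cdot>\<sigma>)^2 = 1\<close>, so
  \<open>(1 - u\<cdot>\<sigma>)^2 = 2 (1 - u\<cdot>\<sigma>)\<close>.\<close>

lemma antiproj_square:
  assumes "(\<Sum>k\<in>{1..3}. (u k)\<^sup>2) = 1"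
  shows "(\<Sum>m\<in>UNIV. antiproj u i m * antiproj u m j) = 2 * antiproj u i j"
proof -
  have u: "u 1 * u 1 + u 2 * u 2 + u 3 * u 3 = 1"
    using assms unfolding sum_1_3 power2_eq_square .
  \<comment> \<open>Oriented as a rewrite rule that eliminates the square of
    \<open>u 1\<close>.\<close>
  have "u 1 * u 1 = 1 - u 2 * u 2 - u 3 * u 3" using u by simp
  then show ?thesis
    unfolding antiproj_def sum_1_3 sum_bool
    by (cases i; cases j) (simp_all add: pauli_def complex_eq_iff algebra_simps)
qed

text \<open>The right-hand side is the expectation of
  \<open>(1 - u\<cdot>\<sigma>) \<otimes> (1 - w\<cdot>\<sigma>)\<close>. This operator is a quarter
  of its own square, so four times the expectation is a sum of values of the form of
  \<open>M\<close>.\<close>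

lemma antiproj_expectation_nonneg:
  fixes M :: op2
  assumes "psd M" and u: "(\<Sum>k\<in>{1..3}. (u k)\<^sup>2) = 1" and w: "(\<Sum>k\<in>{1..3}. (w k)\<^sup>2) = 1"
  shows "0 \<le> tr M - (\<Sum>k\<in>{1..3}. u k * bloch (ptrace2_second M) k)
     - (\<Sum>l\<in>{1..3}. w l * bloch (ptrace2_first M) l)
     + (\<Sum>k\<in>{1..3}. \<Sum>l\<in>{1..3}. u k * w l * corr M k l)"
proof -
  let ?U = "antiproj u" and ?W = "antiproj w"
  \<comment> \<open>\<open>v m\<close> is the column of index \<open>m\<close> of the tensor product
    \<open>U \<otimes> W\<close>.\<close>
  define v where "v = (\<lambda>(p, q) (x, y). ?U x p * ?W y q)"
  let ?E = "\<Sum>i\<in>UNIV. \<Sum>j\<in>UNIV. M i j * (?U (fst j) (fst i) * ?W (snd j) (snd i))"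
  have vv: "(\<Sum>m\<in>UNIV. cnj (v m i) * v m j) = 4 * (?U (fst j) (fst i) * ?W (snd j) (snd i))" for i j
  proof -
    have "(\<Sum>m\<in>UNIV. cnj (v m i) * v m j) =
      (\<Sum>p\<in>UNIV. ?U (fst j) p * ?U p (fst i)) * (\<Sum>q\<in>UNIV. ?W (snd j) q * ?W q (snd i))"
      unfolding sum_pair sum_product v_def
      by (intro sum.cong refl) (simp add: antiproj_hermitian split_beta)
    then show ?thesis unfolding antiproj_square[OF u] antiproj_square[OF w] by simp
  qed
  have "(\<Sum>m\<in>UNIV. \<Sum>i\<in>UNIV. \<Sum>j\<in>UNIV. cnj (v m i) * M i j * v m j)
    = (\<Sum>i\<in>UNIV. \<Sum>m\<in>UNIV. \<Sum>j\<in>UNIV. cnj (v m i) * M i j * v m j)"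
    by (rule sum.swap)
  also have "\<dots> = (\<Sum>i\<in>UNIV. \<Sum>j\<in>UNIV. \<Sum>m\<in>UNIV. cnj (v m i) * M i j * v m j)"
    by (rule sum.cong[OF refl]) (rule sum.swap)
  also have "\<dots> = (\<Sum>i\<in>UNIV. \<Sum>j\<in>UNIV. M i j * (\<Sum>m\<in>UNIV. cnj (v m i) * v m j))"
    by (simp add: sum_distrib_left mult_ac)
  also have "\<dots> = 4 * ?E"
    unfolding vv sum_distrib_left by (simp add: mult_ac)
  finally have "4 * Re ?E = (\<Sum>m\<in>UNIV. qform M (v m))"
    unfolding qform_def Re_sum[symmetric] by simp
  also have "\<dots> \<ge> 0" by (intro sum_nonneg psd_qform assms(1))
  finally have "0 \<le> Re ?E" by simp
  also have "Re ?E = tr M - (\<Sum>k\<in>{1..3}. u k * bloch (ptrace2_second M) k)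
     - (\<Sum>l\<in>{1..3}. w l * bloch (ptrace2_first M) l)
     + (\<Sum>k\<in>{1..3}. \<Sum>l\<in>{1..3}. u k * w l * corr M k l)"
    unfolding corr_def bloch_def ptrace2_second_def ptrace2_first_def
      tr_def pauli_def antiproj_def qubit_sums
    by (simp add: algebra_simps)
  finally show ?thesis .
qed

section \<open>Bloch vectors against correlations of a two-qubit operator\<close>

lemma normalise3:
  fixes b :: "nat \<Rightarrow> real"
  obtains u where "(\<Sum>k\<in>{1..3}. (u k)\<^sup>2) = 1"
    and "(\<Sum>k\<in>{1..3}. u k * b k) = sqrt (\<Sum>k\<in>{1..3}. (b k)\<^sup>2)"
proof (cases "(\<Sum>k\<in>{1..3}. (b k)\<^sup>2) = 0")
  case True
  then have "\<forall>k\<in>{1..3}. b k = 0" by (subst (asm) sum_nonneg_eq_0_iff) auto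
  then have b: "b 1 = 0" "b 2 = 0" "b 3 = 0" by auto
  \<comment> \<open>The zero vector has no direction; any unit vector serves, here the first basis
    vector.\<close>
  show ?thesis
    by (rule that[of "\<lambda>k. if k = 1 then 1 else 0"]; unfold sum_1_3) (simp_all add: b[unfolded One_nat_def])
next
  case False
  let ?r = "\<Sum>k\<in>{1..3}. (b k)\<^sup>2"
  have r: "?r > 0" using False by (metis less_eq_real_def sum_nonneg zero_le_power2)
  show ?thesis
  proof (rule that[of "\<lambda>k. b k / sqrt ?r"])
    show "(\<Sum>k\<in>{1..3}. (b k / sqrt ?r)\<^sup>2) = 1"
      using r by (simp add: power_divide flip: sum_divide_distrib)
    have "(\<Sum>k\<in>{1..3}. b k / sqrt ?r * b k) = ?r / sqrt ?r"
      by (simp add: sum_divide_distrib power2_eq_square)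
    then show "(\<Sum>k\<in>{1..3}. b k / sqrt ?r * b k) = sqrt ?r"
      using r by (simp add: real_div_sqrt)
  qed
qed

text \<open>With \<open>u\<close>, \<open>w\<close> the directions of the two Bloch vectors and
  \<open>t\<close> the correlation along them, the sign choices \<open>(u, w)\<close>,
  \<open>(u, -w)\<close>, \<open>(-u, w)\<close> give three linear inequalities. Adding the first to
  either of the others bounds \<open>b\<close> and \<open>c\<close>; the first alone bounds
  \<open>t\<close> from below.\<close>

lemma psd_bloch_bounds:
  fixes M :: op2
  assumes "psd M"
  defines "b \<equiv> sqrt (bloch_norm2 (ptrace2_second M))"
    and "c \<equiv> sqrt (bloch_norm2 (ptrace2_first M))"
  shows "b \<le> tr M" "c \<le> tr M" "tr M \<le> b + c \<Longrightarrow> (b + c - tr M)\<^sup>2 \<le> S2 M"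
proof -
  obtain u where u: "(\<Sum>k\<in>{1..3}. (u k)\<^sup>2) = 1"
    "(\<Sum>k\<in>{1..3}. u k * bloch (ptrace2_second M) k) = b"
    unfolding b_def bloch_norm2_def by (rule normalise3)
  obtain w where w: "(\<Sum>k\<in>{1..3}. (w k)\<^sup>2) = 1"
    "(\<Sum>k\<in>{1..3}. w k * bloch (ptrace2_first M) k) = c"
    unfolding c_def bloch_norm2_def by (rule normalise3)
  define t where "t = (\<Sum>k\<in>{1..3}. \<Sum>l\<in>{1..3}. u k * w l * corr M k l)"
  have 1: "0 \<le> tr M - b - c + t"
    using antiproj_expectation_nonneg[OF assms(1) u(1) w(1)] u w t_def by simp
  have 2: "0 \<le> tr M - b + c - t"
    using antiproj_expectation_nonneg[OF assms(1) u(1), of "\<lambda>k. - w k"] u w t_def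
    by (simp add: sum_negf)
  have 3: "0 \<le> tr M + b - c - t"
    using antiproj_expectation_nonneg[OF assms(1) _ w(1), of "\<lambda>k. - u k"] u w t_def
    by (simp add: sum_negf)
  show "b \<le> tr M" "c \<le> tr M" using 1 2 3 by auto
  let ?K = "{1..3::nat} \<times> {1..3::nat}"
  have "t\<^sup>2 = (\<Sum>p\<in>?K. (u (fst p) * w (snd p)) * corr M (fst p) (snd p))\<^sup>2"
    unfolding t_def sum.cartesian_product by (simp add: split_beta)
  \<comment> \<open>The coefficient array \<open>u k * w l\<close> has Euclidean norm 1, so
    Cauchy-Schwarz bounds \<open>t^2\<close> by \<open>S2 M\<close>.\<close>
  also have "\<dots> \<le> (\<Sum>p\<in>?K. (u (fst p) * w (snd p))\<^sup>2) * (\<Sum>p\<in>?K. (corr M (fst p) (snd p))\<^sup>2)"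
    by (rule Cauchy_Schwarz_ineq_sum)
  also have "(\<Sum>p\<in>?K. (u (fst p) * w (snd p))\<^sup>2) = (\<Sum>k\<in>{1..3}. (u k)\<^sup>2) * (\<Sum>l\<in>{1..3}. (w l)\<^sup>2)"
    unfolding sum_product sum.cartesian_product by (simp add: split_beta power_mult_distrib)
  also have "(\<Sum>p\<in>?K. (corr M (fst p) (snd p))\<^sup>2) = S2 M"
    unfolding S2_def sum.cartesian_product by (simp add: split_beta)
  finally have "t\<^sup>2 \<le> S2 M" using u w by simp
  moreover assume "tr M \<le> b + c"
  then have "(b + c - tr M)\<^sup>2 \<le> t\<^sup>2" using 1 by (intro power_mono) auto
  ultimately show "(b + c - tr M)\<^sup>2 \<le> S2 M" by simp
qed

lemma psd_bloch_corr:
  fixes M :: op2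
  assumes "psd M"
  shows "3 * (bloch_norm2 (ptrace2_second M) + bloch_norm2 (ptrace2_first M)) - S2 M
    \<le> 5 * (tr M)\<^sup>2"
proof -
  define b c n where "b = sqrt (bloch_norm2 (ptrace2_second M))"
    and "c = sqrt (bloch_norm2 (ptrace2_first M))" and "n = tr M"
  have bc: "0 \<le> b" "0 \<le> c" "b\<^sup>2 = bloch_norm2 (ptrace2_second M)" "c\<^sup>2 = bloch_norm2 (ptrace2_first M)"
    unfolding b_def c_def by (auto simp: bloch_norm2_nonneg)
  note bnd = psd_bloch_bounds[OF assms, folded b_def c_def n_def]
  have S: "0 \<le> S2 M" unfolding S2_def by (simp add: sum_nonneg)
  have "3 * (b\<^sup>2 + c\<^sup>2) - S2 M \<le> 5 * n\<^sup>2"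
  proof (cases "n \<le> b + c")
    case True
    \<comment> \<open>The slack of the inequality below is exactly twice the sum of these five
      products.\<close>
    have "0 \<le> (n - b) * (n - c)" "0 \<le> b * (n - b)" "0 \<le> c * (n - c)" "0 \<le> n * (n - b)" "0 \<le> n * (n - c)"
      using bnd(1,2) bc(1,2) by (simp_all add: mult_nonneg_nonneg)
    then have "3 * (b\<^sup>2 + c\<^sup>2) - (b + c - n)\<^sup>2 \<le> 5 * n\<^sup>2"
      by (simp add: power2_eq_square algebra_simps)
    then show ?thesis using bnd(3)[OF True] by linarith
  next
    case False
    \<comment> \<open>Here \<open>b^2 + c^2 \<le> (b + c)^2 \<le> n^2\<close>, so even
      \<open>3 n^2\<close> suffices.\<close>
    then have "(b + c)\<^sup>2 \<le> n\<^sup>2" using bc by (intro power_mono) auto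
    moreover have "0 \<le> b * c" using bc by simp
    ultimately show ?thesis using S zero_le_power2[of n] unfolding power2_sum distrib_left mult.assoc by linarith
  qed
  then show ?thesis unfolding bc n_def .
qed

section \<open>Three-qubit operators\<close>

lemmas rho_defs = rho_A_def rho_B_def rho_C_def rho_AB_def rho_AC_def rho_BC_def
  ptrace2_first_def ptrace2_second_def ptrace_A_def ptrace_B_def ptrace_C_def

lemma rho_marginals:
  "rho_A \<rho> = ptrace2_second (rho_AB \<rho>)" "rho_A \<rho> = ptrace2_second (rho_AC \<rho>)"
  "rho_B \<rho> = ptrace2_first (rho_AB \<rho>)" "rho_B \<rho> = ptrace2_second (rho_BC \<rho>)"
  "rho_C \<rho> = ptrace2_first (rho_AC \<rho>)" "rho_C \<rho> = ptrace2_first (rho_BC \<rho>)"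
  by (auto simp: rho_defs fun_eq_iff sum_bool)

lemma tr_rho:
  "tr (rho_AB \<rho>) = tr \<rho>" "tr (rho_AC \<rho>) = tr \<rho>" "tr (rho_BC \<rho>) = tr \<rho>"
  "tr (rho_A \<rho>) = tr \<rho>" "tr (rho_B \<rho>) = tr \<rho>" "tr (rho_C \<rho>) = tr \<rho>"
  by (simp_all add: rho_defs tr_def qubit_sums)

text \<open>Tracing out one qubit of a pure operator leaves a sum of two rank-one operators, one for
  each basis state of that qubit, and the form of a rank-one operator is a squared modulus.\<close>

lemma psd_pure_marginals:
  fixes v :: "bool \<times> bool \<times> bool \<Rightarrow> complex"
  shows "psd (rho_AB (pure v))" "psd (rho_AC (pure v))" "psd (rho_BC (pure v))"
proof -
  have psd_sum: "psd M" if "\<And>i j. M i j = pure x i j + pure y i j" for M :: op2 and x y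
  proof -
    have "qform M w = (cmod (\<Sum>i\<in>UNIV. cnj (w i) * x i))\<^sup>2 + (cmod (\<Sum>i\<in>UNIV. cnj (w i) * y i))\<^sup>2" for w
    proof -
      have *: "qform (pure z) w = (cmod (\<Sum>i\<in>UNIV. cnj (w i) * z i))\<^sup>2" for z
      proof -
        let ?s = "\<Sum>i\<in>UNIV. cnj (w i) * z i"
        have "(\<Sum>i\<in>UNIV. \<Sum>j\<in>UNIV. cnj (w i) * pure z i j * w j) = ?s * cnj ?s"
          unfolding cnj_sum sum_product pure_def by (simp add: mult_ac)
        then show ?thesis unfolding qform_def complex_norm_square[symmetric] by (simp del: of_real_power)
      qed
      show ?thesis unfolding *[symmetric] unfolding qform_def that
        by (simp add: algebra_simps sum.distrib)
    qed
    then show ?thesis unfolding psd_def by (simp add: that pure_def)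
  qed
  show "psd (rho_AB (pure v))"
    by (rule psd_sum[of _ "\<lambda>(a, b). v (a, b, False)" "\<lambda>(a, b). v (a, b, True)"])
      (auto simp: rho_defs pure_def sum_bool)
  show "psd (rho_AC (pure v))"
    by (rule psd_sum[of _ "\<lambda>(a, c). v (a, False, c)" "\<lambda>(a, c). v (a, True, c)"])
      (auto simp: rho_defs pure_def sum_bool)
  show "psd (rho_BC (pure v))"
    by (rule psd_sum[of _ "\<lambda>(b, c). v (False, b, c)" "\<lambda>(b, c). v (True, b, c)"])
      (auto simp: rho_defs pure_def sum_bool)
qed

text \<open>If the amplitudes are arranged as a matrix \<open>X\<close> with the single qubit as
  column index, the two marginals are \<open>X X^*\<close> and the transpose of
  \<open>X^* X\<close>, whose squares have equal trace.\<close>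

lemma pure_purity:
  fixes v :: "bool \<times> bool \<times> bool \<Rightarrow> complex"
  defines "\<rho> \<equiv> pure v"
  shows "(\<Sum>i\<in>UNIV. \<Sum>j\<in>UNIV. (cmod (rho_AB \<rho> i j))\<^sup>2) = (\<Sum>i\<in>UNIV. \<Sum>j\<in>UNIV. (cmod (rho_C \<rho> i j))\<^sup>2)"
    and "(\<Sum>i\<in>UNIV. \<Sum>j\<in>UNIV. (cmod (rho_AC \<rho> i j))\<^sup>2) = (\<Sum>i\<in>UNIV. \<Sum>j\<in>UNIV. (cmod (rho_B \<rho> i j))\<^sup>2)"
    and "(\<Sum>i\<in>UNIV. \<Sum>j\<in>UNIV. (cmod (rho_BC \<rho> i j))\<^sup>2) = (\<Sum>i\<in>UNIV. \<Sum>j\<in>UNIV. (cmod (rho_A \<rho> i j))\<^sup>2)"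
proof -
  \<comment> \<open>Over the complex numbers a squared modulus becomes \<open>z * cnj z\<close>,
    which makes each identity polynomial in the amplitudes and their conjugates.\<close>
  have *: "x = y" if "complex_of_real x = complex_of_real y" for x y
    using that by (simp only: of_real_eq_iff)
  show "(\<Sum>i\<in>UNIV. \<Sum>j\<in>UNIV. (cmod (rho_AB \<rho> i j))\<^sup>2) = (\<Sum>i\<in>UNIV. \<Sum>j\<in>UNIV. (cmod (rho_C \<rho> i j))\<^sup>2)"
    by (rule *, simp only: of_real_sum complex_norm_square)
      (simp add: \<rho>_def pure_def rho_defs qubit_sums algebra_simps)
  show "(\<Sum>i\<in>UNIV. \<Sum>j\<in>UNIV. (cmod (rho_AC \<rho> i j))\<^sup>2) = (\<Sum>i\<in>UNIV. \<Sum>j\<in>UNIV. (cmod (rho_B \<rho> i j))\<^sup>2)"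
    by (rule *, simp only: of_real_sum complex_norm_square)
      (simp add: \<rho>_def pure_def rho_defs qubit_sums algebra_simps)
  show "(\<Sum>i\<in>UNIV. \<Sum>j\<in>UNIV. (cmod (rho_BC \<rho> i j))\<^sup>2) = (\<Sum>i\<in>UNIV. \<Sum>j\<in>UNIV. (cmod (rho_A \<rho> i j))\<^sup>2)"
    by (rule *, simp only: of_real_sum complex_norm_square)
      (simp add: \<rho>_def pure_def rho_defs qubit_sums algebra_simps)
qed

section \<open>Local and nonlocal information of pure operators\<close>

abbreviation "normA2 \<rho> \<equiv> bloch_norm2 (rho_A \<rho>)"
abbreviation "normB2 \<rho> \<equiv> bloch_norm2 (rho_B \<rho>)"
abbreviation "normC2 \<rho> \<equiv> bloch_norm2 (rho_C \<rho>)"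
abbreviation "S_AB \<rho> \<equiv> S2 (rho_AB \<rho>)"
abbreviation "S_AC \<rho> \<equiv> S2 (rho_AC \<rho>)"
abbreviation "S_BC \<rho> \<equiv> S2 (rho_BC \<rho>)"

text \<open>For the first identity: \<open>4 P_AB = n^2 + |a|^2 + |b|^2 + S_AB\<close> and
  \<open>2 P_C = n^2 + |c|^2\<close>, where \<open>n\<close> is the trace and the purities
  \<open>P_AB\<close> and \<open>P_C\<close> agree. The others follow by permuting the
  qubits.\<close>

lemma pure_corr:
  fixes v :: "bool \<times> bool \<times> bool \<Rightarrow> complex"
  defines "\<rho> \<equiv> pure v"
  shows "S_AB \<rho> = (tr \<rho>)\<^sup>2 + 2 * normC2 \<rho> - normA2 \<rho> - normB2 \<rho>"
    and "S_AC \<rho> = (tr \<rho>)\<^sup>2 + 2 * normB2 \<rho> - normA2 \<rho> - normC2 \<rho>"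
    and "S_BC \<rho> = (tr \<rho>)\<^sup>2 + 2 * normA2 \<rho> - normB2 \<rho> - normC2 \<rho>"
proof -
  have h1: "rho_A \<rho> i j = cnj (rho_A \<rho> j i)" "rho_B \<rho> i j = cnj (rho_B \<rho> j i)"
    "rho_C \<rho> i j = cnj (rho_C \<rho> j i)" for i j
    by (simp_all add: \<rho>_def pure_def rho_defs sum_bool)
  have h2: "rho_AB \<rho> i j = cnj (rho_AB \<rho> j i)" "rho_AC \<rho> i j = cnj (rho_AC \<rho> j i)"
    "rho_BC \<rho> i j = cnj (rho_BC \<rho> j i)" for i j
    using psd_pure_marginals[of v] unfolding \<rho>_def by (auto intro: psd_hermitian)
  note purities = purity1[of "rho_A \<rho>", OF h1(1)] purity1[of "rho_B \<rho>", OF h1(2)]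
    purity1[of "rho_C \<rho>", OF h1(3)] purity2[of "rho_AB \<rho>", OF h2(1)]
    purity2[of "rho_AC \<rho>", OF h2(2)] purity2[of "rho_BC \<rho>", OF h2(3)]
    pure_purity[of v, folded \<rho>_def]
  show "S_AB \<rho> = (tr \<rho>)\<^sup>2 + 2 * normC2 \<rho> - normA2 \<rho> - normB2 \<rho>"
    using purities unfolding tr_rho rho_marginals(1,3)[symmetric] by linarith
  show "S_AC \<rho> = (tr \<rho>)\<^sup>2 + 2 * normB2 \<rho> - normA2 \<rho> - normC2 \<rho>"
    using purities unfolding tr_rho rho_marginals(2,5)[symmetric] by linarith
  show "S_BC \<rho> = (tr \<rho>)\<^sup>2 + 2 * normA2 \<rho> - normB2 \<rho> - normC2 \<rho>"
    using purities unfolding tr_rho rho_marginals(4,6)[symmetric] by linarith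
qed

text \<open>Weights 0 and 1 record which of the maxima \<open>max 0 (S - 1)\<close> are attained by
  \<open>S - 1\<close>; each such term raises the bound 3 by one.\<close>

definition weighted_info :: "real \<Rightarrow> real \<Rightarrow> real \<Rightarrow> op3 \<Rightarrow> real" where
  "weighted_info x y z \<rho> =
     normA2 \<rho> + normB2 \<rho> + normC2 \<rho> + x * S_AB \<rho> + y * S_AC \<rho> + z * S_BC \<rho>"

text \<open>By \<open>pure_corr\<close>, one correlation term leaves \<open>n^2 + 3 |c|^2\<close> up
  to permutation, and two leave \<open>2 n^2 + 2 |b|^2 + 2 |c|^2 - |a|^2\<close>. The latter is
  bounded by \<open>psd_bloch_corr\<close> for the pair whose correlation term is absent.\<close>

lemma weighted_info_pure:
  "weighted_info 0 0 0 (pure v) \<le> 3 * (tr (pure v))\<^sup>2"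
  "weighted_info 1 0 0 (pure v) \<le> 4 * (tr (pure v))\<^sup>2"
  "weighted_info 0 1 0 (pure v) \<le> 4 * (tr (pure v))\<^sup>2"
  "weighted_info 0 0 1 (pure v) \<le> 4 * (tr (pure v))\<^sup>2"
  "weighted_info 1 1 0 (pure v) \<le> 5 * (tr (pure v))\<^sup>2"
  "weighted_info 1 0 1 (pure v) \<le> 5 * (tr (pure v))\<^sup>2"
  "weighted_info 0 1 1 (pure v) \<le> 5 * (tr (pure v))\<^sup>2"
proof -
  let ?r = "pure v"
  have sq: "x \<le> n\<^sup>2" if "sqrt x \<le> n" "0 \<le> x" for x n :: real
    using that by (metis real_sqrt_le_iff real_sqrt_pow2_iff power_mono real_sqrt_ge_zero)
  have "normA2 ?r \<le> (tr ?r)\<^sup>2" "normB2 ?r \<le> (tr ?r)\<^sup>2" "normC2 ?r \<le> (tr ?r)\<^sup>2"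
    using psd_bloch_bounds(1,2)[OF psd_pure_marginals(1), of v]
      psd_bloch_bounds(1,2)[OF psd_pure_marginals(2), of v]
    unfolding tr_rho rho_marginals[symmetric] by (auto intro!: sq bloch_norm2_nonneg)
  moreover have "3 * (normA2 ?r + normB2 ?r) - S_AB ?r \<le> 5 * (tr ?r)\<^sup>2"
    using psd_bloch_corr[OF psd_pure_marginals(1), of v]
    unfolding tr_rho rho_marginals(1,3)[symmetric] .
  moreover have "3 * (normA2 ?r + normC2 ?r) - S_AC ?r \<le> 5 * (tr ?r)\<^sup>2"
    using psd_bloch_corr[OF psd_pure_marginals(2), of v]
    unfolding tr_rho rho_marginals(2,5)[symmetric] .
  moreover have "3 * (normB2 ?r + normC2 ?r) - S_BC ?r \<le> 5 * (tr ?r)\<^sup>2"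
    using psd_bloch_corr[OF psd_pure_marginals(3), of v]
    unfolding tr_rho rho_marginals(4,6)[symmetric] .
  ultimately show
    "weighted_info 0 0 0 ?r \<le> 3 * (tr ?r)\<^sup>2"
    "weighted_info 1 0 0 ?r \<le> 4 * (tr ?r)\<^sup>2"
    "weighted_info 0 1 0 ?r \<le> 4 * (tr ?r)\<^sup>2"
    "weighted_info 0 0 1 ?r \<le> 4 * (tr ?r)\<^sup>2"
    "weighted_info 1 1 0 ?r \<le> 5 * (tr ?r)\<^sup>2"
    "weighted_info 1 0 1 ?r \<le> 5 * (tr ?r)\<^sup>2"
    "weighted_info 0 1 1 ?r \<le> 5 * (tr ?r)\<^sup>2"
    unfolding weighted_info_def pure_corr by (simp_all only: mult_1 mult_zero_left distrib_left)
qed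

section \<open>Convexity and the passage from pure to mixed states\<close>

lemma weighted_square_add:
  fixes x y p q :: real
  assumes "0 < p" "0 < q"
  shows "(x + y)\<^sup>2 \<le> (p + q) / p * x\<^sup>2 + (p + q) / q * y\<^sup>2"
proof -
  \<comment> \<open>The slack in \<open>(x + y)^2 / (p + q) \<le> x^2 / p + y^2 / q\<close>, scaled
    by \<open>p + q\<close>, is a perfect square over \<open>p q\<close>.\<close>
  have "(p + q) / p * x\<^sup>2 + (p + q) / q * y\<^sup>2 - (x + y)\<^sup>2 = (q * x - p * y)\<^sup>2 / (p * q)"
    using assms by (simp add: field_simps power2_eq_square)
  also have "\<dots> \<ge> 0" using assms by simp
  finally show ?thesis by simp
qed

lemma rho_madd:
  "rho_A (madd \<rho> \<sigma>) = madd (rho_A \<rho>) (rho_A \<sigma>)"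
  "rho_B (madd \<rho> \<sigma>) = madd (rho_B \<rho>) (rho_B \<sigma>)"
  "rho_C (madd \<rho> \<sigma>) = madd (rho_C \<rho>) (rho_C \<sigma>)"
  "rho_AB (madd \<rho> \<sigma>) = madd (rho_AB \<rho>) (rho_AB \<sigma>)"
  "rho_AC (madd \<rho> \<sigma>) = madd (rho_AC \<rho>) (rho_AC \<sigma>)"
  "rho_BC (madd \<rho> \<sigma>) = madd (rho_BC \<rho>) (rho_BC \<sigma>)"
  by (simp_all add: fun_eq_iff rho_defs madd_def sum_bool)

lemma tr_madd: "tr (madd M N) = tr M + tr N"
  by (simp add: tr_def madd_def sum.distrib)

lemma bloch_madd: "bloch (madd M N) k = bloch M k + bloch N k"
  by (simp only: bloch_def madd_def distrib_right sum.distrib plus_complex.sel)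

lemma corr_madd: "corr (madd M N) k l = corr M k l + corr N k l"
  unfolding corr_def madd_def split_def distrib_right sum.distrib plus_complex.sel ..

lemma bloch_norm2_madd:
  assumes "0 < p" "0 < q"
  shows "bloch_norm2 (madd M N) \<le> (p + q) / p * bloch_norm2 M + (p + q) / q * bloch_norm2 N"
  unfolding bloch_norm2_def sum_distrib_left sum.distrib[symmetric] bloch_madd
  by (intro sum_mono weighted_square_add assms)

lemma S2_madd:
  assumes "0 < p" "0 < q"
  shows "S2 (madd M N) \<le> (p + q) / p * S2 M + (p + q) / q * S2 N"
  unfolding S2_def sum_distrib_left sum.distrib[symmetric] corr_madd
  by (intro sum_mono weighted_square_add assms)

lemma weighted_info_madd:
  assumes "0 \<le> x" "0 \<le> y" "0 \<le> z" and pos: "0 < p" "0 < q"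
  shows "weighted_info x y z (madd \<rho> \<sigma>)
    \<le> (p + q) / p * weighted_info x y z \<rho> + (p + q) / q * weighted_info x y z \<sigma>"
proof -
  define r s where "r = (p + q) / p" and "s = (p + q) / q"
  note N = bloch_norm2_madd[OF pos, folded r_def s_def]
  have S: "w * S2 (madd M N) \<le> r * (w * S2 M) + s * (w * S2 N)" if "0 \<le> w" for w M N
    using mult_left_mono[OF S2_madd[OF pos] that, folded r_def s_def, of M N]
    by (simp only: distrib_left mult.left_commute)
  show ?thesis
    unfolding weighted_info_def rho_madd r_def[symmetric] s_def[symmetric] distrib_left
    using N[of "rho_A \<rho>" "rho_A \<sigma>"] N[of "rho_B \<rho>" "rho_B \<sigma>"] N[of "rho_C \<rho>" "rho_C \<sigma>"]
      S[OF assms(1), of "rho_AB \<rho>" "rho_AB \<sigma>"] S[OF assms(2), of "rho_AC \<rho>" "rho_AC \<sigma>"]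
      S[OF assms(3), of "rho_BC \<rho>" "rho_BC \<sigma>"]
    by linarith
qed

text \<open>Convexity is applied with the traces of the two summands as \<open>p\<close> and
  \<open>q\<close>; then \<open>(p + q) / p * C p^2 + (p + q) / q * C q^2 = C (p + q)^2\<close>, so
  the bound passes to sums.\<close>

lemma weighted_info_psd:
  assumes "psd \<rho>" and nonneg: "0 \<le> x" "0 \<le> y" "0 \<le> z"
    and bound: "\<And>v. weighted_info x y z (pure v) \<le> C * (tr (pure v))\<^sup>2"
  shows "weighted_info x y z \<rho> \<le> C * (tr \<rho>)\<^sup>2"
proof -
  \<comment> \<open>The second conjunct is carried along because the addition step divides by the
    traces; a zero summand is treated separately.\<close>
  have "weighted_info x y z \<rho> \<le> C * (tr \<rho>)\<^sup>2 \<and> (\<rho> = (\<lambda>_ _. 0) \<or> 0 < tr \<rho>)"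
    using assms(1)
  proof (induction rule: psd_induct)
    case zero
    then show ?case
      by (simp add: weighted_info_def rho_defs tr_def S2_def corr_def bloch_norm2_def bloch_def split_beta)
  next
    case (pure v)
    have tr: "tr (pure v) = (\<Sum>i\<in>UNIV. (cmod (v i))\<^sup>2)"
      unfolding tr_def pure_def Re_sum cmod_power2 by (simp add: power2_eq_square)
    have "pure v = (\<lambda>_ _. 0)" if "\<not> 0 < tr (pure v)"
    proof -
      have "(\<Sum>i\<in>UNIV. (cmod (v i))\<^sup>2) = 0"
        using that sum_nonneg[of UNIV "\<lambda>i. (cmod (v i))\<^sup>2"] unfolding tr by fastforce
      then have "v i = 0" for i by (cases i) (simp add: sum_nonneg_eq_0_iff)
      then show ?thesis by (simp add: pure_def)
    qed
    then show ?case using bound[of v] by argo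
  next
    case (add M N)
    show ?case
    proof (cases "M = (\<lambda>_ _. 0) \<or> N = (\<lambda>_ _. 0)")
      case True
      moreover have "madd (\<lambda>_ _. 0) N = N" "madd M (\<lambda>_ _. 0) = M" by (simp_all add: madd_def)
      ultimately show ?thesis using add by metis
    next
      case False
      let ?p = "tr M" and ?q = "tr N"
      have pos: "0 < ?p" "0 < ?q" using False add by auto
      have "weighted_info x y z (madd M N)
        \<le> (?p + ?q) / ?p * weighted_info x y z M + (?p + ?q) / ?q * weighted_info x y z N"
        by (rule weighted_info_madd[OF nonneg pos])
      also have "\<dots> \<le> (?p + ?q) / ?p * (C * ?p\<^sup>2) + (?p + ?q) / ?q * (C * ?q\<^sup>2)"
        using add pos by (intro add_mono mult_left_mono) auto
      also have "\<dots> = C * (tr (madd M N))\<^sup>2"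
        using pos unfolding tr_madd by (simp add: field_simps power2_eq_square)
      finally show ?thesis using pos unfolding tr_madd by simp
    qed
  qed
  then show ?thesis ..
qed

theorem theorem7:
  fixes \<rho> :: op3
  assumes "density3 \<rho>"
  shows "I_local \<rho> + I_nonlocal \<rho> \<le> 3"
proof -
  have psd: "psd \<rho>"
    using assms unfolding density3_def psd_def qform_def by blast
  have "(\<Sum>i\<in>UNIV. \<rho> i i) = 1"
    using assms unfolding density3_def by blast
  then have tr: "tr \<rho> = 1"
    unfolding tr_def by simp
  \<comment> \<open>The rotation brings the pure-state premise to the front, so that each of the
    seven pure bounds extends to \<open>\<rho>\<close>, whose trace is 1.\<close>
  note bounds = weighted_info_pure[THEN weighted_info_psd[OF psd, rotated 3],
      unfolded weighted_info_def tr, simplified]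
  \<comment> \<open>The four hypotheses match the four ways in which the two maxima can
    resolve.\<close>
  have *: "I_local \<rho> + (max 0 (s - 1) + max 0 (t - 1)) \<le> 3"
    if "I_local \<rho> \<le> 3" "I_local \<rho> + s \<le> 4" "I_local \<rho> + t \<le> 4" "I_local \<rho> + s + t \<le> 5" for s t
    using that by (auto simp: max_def)
  have "I_local \<rho> + (Nq (rho_AB \<rho>) + Nq (rho_AC \<rho>)) \<le> 3"
    "I_local \<rho> + (Nq (rho_AB \<rho>) + Nq (rho_BC \<rho>)) \<le> 3"
    "I_local \<rho> + (Nq (rho_AC \<rho>) + Nq (rho_BC \<rho>)) \<le> 3"
    unfolding Nq_def by (rule *; use bounds in \<open>simp add: I_local_def\<close>)+
  then show ?thesis
    unfolding I_nonlocal_def by simp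
qed

end
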